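(* Let $A\in\mathbb{R}^{m\times n}$, let $f:\mathbb{R}^m\to\mathbb{R}$ and $g:\mathbb{R}^n\to\mathbb{R}\cup\{+\infty\}$ be proper, closed and convex, and let $\alpha>0$ be such that $f$ is differentiable on $\mathbb{R}^m$ with $\|\nabla f(z)-\nabla f(z')\|_2\le \alpha^{-1}\|z-z'\|_2$ for all $z,z'\in\mathbb{R}^m$. Let $P(x)=f(Ax)+g(x)$ and $D(u)=-f^*(-u)-g^*(A^{\top}u)$, and assume $P$ has at least one minimizer over $\mathbb{R}^n$. Then for every $(x,u)\in\mathrm{dom}(P)\times\mathrm{dom}(-D)$, $$\mathcal{B}_{\mathrm{RYU}}(x,u)\subseteq \mathcal{B}(c_{\mathrm{GAP}},r_{\mathrm{GAP}}),\qquad c_{\mathrm{GAP}}=u,\quad r_{\mathrm{GAP}}=\sqrt{\frac{2\,(P(x)-D(u))}{\alpha}}.$$ Moreover, the inclusion is strict whenever the pair $(x,u)$ is not optimal (i.e. unless $x$ minimizes $P$ and $u$ maximizes $D$).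
   Context: $h^*(z^* )=\sup_z \langle z^*,z\rangle-h(z)$ denotes the convex conjugate of $h$, and $\mathrm{dom}(h)=\{z: h(z)<+\infty\}$. $\mathcal{B}(c,r)=\{v\in\mathbb{R}^m:\|v-c\|_2\le r\}$ for $r\ge 0$. The RYU ball is $\mathcal{B}_{\mathrm{RYU}}(x,u)=\mathcal{B}(c_{\mathrm{RYU}},r_{\mathrm{RYU}})$ with $c_{\mathrm{RYU}}=\frac12(u-\nabla f(Ax))$ and $r_{\mathrm{RYU}}=\sqrt{\frac{P(x)-D(u)}{\alpha}-\frac{\|u+\nabla f(Ax)\|_2^2}{4}}$; the quantity under the square root is nonnegative under the stated assumptions. *)

theory Defs
  imports "HOL-Analysis.Analysis"
begin

section \<open>Extended-real-valued convex functions\<close>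

definition eff_dom :: "('a \<Rightarrow> ereal) \<Rightarrow> 'a set" where
  "eff_dom h = {z. h z < \<infinity>}"

definition proper_fun :: "('a \<Rightarrow> ereal) \<Rightarrow> bool" where
  "proper_fun h \<longleftrightarrow> (\<forall>z. h z \<noteq> -\<infinity>) \<and> eff_dom h \<noteq> {}"

text \<open>The library's \<open>epigraph\<close> and \<open>convex_on\<close> are for real-valued functions only.\<close>

definition epi :: "('a \<Rightarrow> ereal) \<Rightarrow> ('a \<times> real) set" where
  "epi h = {(z, t). h z \<le> ereal t}"

definition closed_fun :: "('a::topological_space \<Rightarrow> ereal) \<Rightarrow> bool" where
  "closed_fun h \<longleftrightarrow> closed (epi h)"

definition convex_fun :: "('a::real_vector \<Rightarrow> ereal) \<Rightarrow> bool" where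
  "convex_fun h \<longleftrightarrow> convex (epi h)"

definition conjugate :: "('a::real_inner \<Rightarrow> ereal) \<Rightarrow> 'a \<Rightarrow> ereal" where
  "conjugate h w = (SUP z. ereal (w \<bullet> z) - h z)"

definition grad :: "('a::real_inner \<Rightarrow> real) \<Rightarrow> 'a \<Rightarrow> 'a" where
  "grad f z = (THE D. GDERIV f z :> D)"

section \<open>The primal-dual pair\<close>

definition primal :: "real^'n^'m \<Rightarrow> (real^'m \<Rightarrow> real) \<Rightarrow> (real^'n \<Rightarrow> ereal) \<Rightarrow> real^'n \<Rightarrow> ereal" where
  "primal A f g x = ereal (f (A *v x)) + g x"

text \<open>For proper \<open>f\<close> and \<open>g\<close> both conjugates are \<open>> -\<infinity>\<close>, so no \<open>\<infinity> - \<infinity>\<close> occurs below.\<close>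

definition dual :: "real^'n^'m \<Rightarrow> (real^'m \<Rightarrow> real) \<Rightarrow> (real^'n \<Rightarrow> ereal) \<Rightarrow> real^'m \<Rightarrow> ereal" where
  "dual A f g u = - conjugate (\<lambda>z. ereal (f z)) (- u) - conjugate g (transpose A *v u)"

text \<open>The gap is finite on \<open>dom P \<times> dom (-D)\<close>, the only place where it is used; there
  \<open>real_of_ereal\<close> is a mere change of type.\<close>

definition gap :: "real^'n^'m \<Rightarrow> (real^'m \<Rightarrow> real) \<Rightarrow> (real^'n \<Rightarrow> ereal) \<Rightarrow> real^'n \<Rightarrow> real^'m \<Rightarrow> real" where
  "gap A f g x u = real_of_ereal (primal A f g x - dual A f g u)"

definition c_RYU :: "real^'n^'m \<Rightarrow> (real^'m \<Rightarrow> real) \<Rightarrow> real^'n \<Rightarrow> real^'m \<Rightarrow> real^'m" where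
  "c_RYU A f x u = (1/2) *\<^sub>R (u - grad f (A *v x))"

text \<open>The radicand is nonnegative under the standing assumptions, see \<open>RYU_radicand_nonneg\<close>
  at the end of this theory; so the ball is never the empty \<open>cball\<close> of a negative radius.\<close>

definition r_RYU ::
  "real^'n^'m \<Rightarrow> (real^'m \<Rightarrow> real) \<Rightarrow> (real^'n \<Rightarrow> ereal) \<Rightarrow> real \<Rightarrow> real^'n \<Rightarrow> real^'m \<Rightarrow> real" where
  "r_RYU A f g \<alpha> x u = sqrt (gap A f g x u / \<alpha> - (norm (u + grad f (A *v x)))\<^sup>2 / 4)"

definition B_RYU ::
  "real^'n^'m \<Rightarrow> (real^'m \<Rightarrow> real) \<Rightarrow> (real^'n \<Rightarrow> ereal) \<Rightarrow> real \<Rightarrow> real^'n \<Rightarrow> real^'m \<Rightarrow> (real^'m) set" where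
  "B_RYU A f g \<alpha> x u = cball (c_RYU A f x u) (r_RYU A f g \<alpha> x u)"

definition c_GAP :: "real^'m \<Rightarrow> real^'m" where
  "c_GAP u = u"

definition r_GAP ::
  "real^'n^'m \<Rightarrow> (real^'m \<Rightarrow> real) \<Rightarrow> (real^'n \<Rightarrow> ereal) \<Rightarrow> real \<Rightarrow> real^'n \<Rightarrow> real^'m \<Rightarrow> real" where
  "r_GAP A f g \<alpha> x u = sqrt (2 * gap A f g x u / \<alpha>)"

definition optimal_pair ::
  "real^'n^'m \<Rightarrow> (real^'m \<Rightarrow> real) \<Rightarrow> (real^'n \<Rightarrow> ereal) \<Rightarrow> real^'n \<Rightarrow> real^'m \<Rightarrow> bool" where
  "optimal_pair A f g x u \<longleftrightarrow>
     (\<forall>y. primal A f g x \<le> primal A f g y) \<and> (\<forall>v. dual A f g v \<le> dual A f g u)"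

section \<open>Well-definedness of the gradient, the gap and the radius\<close>

lemma GDERIV_grad:
  fixes f :: "'a::euclidean_space \<Rightarrow> real"
  assumes "f differentiable (at z)"
  shows "GDERIV f z :> grad f z"
proof -
  obtain f' where f': "(f has_derivative f') (at z)"
    using assms by (auto simp: differentiable_def)
  have "f' h = h \<bullet> adjoint f' 1" for h
    using adjoint_works[OF has_derivative_linear[OF f'], of h 1] by simp
  hence "f' = (\<lambda>h. h \<bullet> adjoint f' 1)" by auto
  with f' have D: "GDERIV f z :> adjoint f' 1"
    by (simp add: gderiv_def)
  moreover have "E = adjoint f' 1" if "GDERIV f z :> E" for E
  proof -
    have "(\<lambda>h. h \<bullet> E) = (\<lambda>h. h \<bullet> adjoint f' 1)"
      using has_derivative_unique that D unfolding gderiv_def by blast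
    hence "\<forall>h. h \<bullet> E = h \<bullet> adjoint f' 1" by metis
    thus ?thesis using vector_eq_ldot by blast
  qed
  ultimately show ?thesis
    unfolding grad_def by (rule theI)
qed

lemma conjugate_ge: "ereal (w \<bullet> z) - h z \<le> conjugate h w"
  unfolding conjugate_def by (rule SUP_upper) simp

lemma gap_decomp:
  fixes A :: "real^'n^'m"
  assumes "proper_fun g" and x: "x \<in> eff_dom (primal A f g)"
    and u: "u \<in> eff_dom (\<lambda>v. - dual A f g v)"
  obtains p q r where "g x = ereal p" "conjugate (\<lambda>z. ereal (f z)) (- u) = ereal q"
    "conjugate g (transpose A *v u) = ereal r"
    "primal A f g x = ereal (f (A *v x) + p)" "dual A f g u = ereal (- q - r)"
    "gap A f g x u = f (A *v x) + p + q + r"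
proof -
  have gx: "g x \<noteq> -\<infinity>" "g x \<noteq> \<infinity>"
    using assms(1) x by (auto simp: proper_fun_def eff_dom_def primal_def)
  then obtain p where p: "g x = ereal p" by (cases "g x") auto
  have "conjugate (\<lambda>z. ereal (f z)) (- u) \<noteq> -\<infinity>"
    using conjugate_ge[of "- u" 0 "\<lambda>z. ereal (f z)"] by auto
  moreover have "conjugate g (transpose A *v u) \<noteq> -\<infinity>"
    using conjugate_ge[of "transpose A *v u" x g] p by auto
  ultimately obtain q r where qr: "conjugate (\<lambda>z. ereal (f z)) (- u) = ereal q"
    "conjugate g (transpose A *v u) = ereal r"
    using u unfolding eff_dom_def dual_def
    by (cases "conjugate (\<lambda>z. ereal (f z)) (- u)"; cases "conjugate g (transpose A *v u)") auto
  show thesis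
    by (rule that[OF p qr]) (simp_all add: gap_def primal_def dual_def p qr del: transpose_matrix_vector)
qed

lemma descent:
  fixes f :: "'a::euclidean_space \<Rightarrow> real"
  assumes diff: "\<And>z. f differentiable (at z)"
    and lip: "\<And>z z'. norm (grad f z - grad f z') \<le> L * norm (z - z')"
  shows "f (y + d) \<le> f y + grad f y \<bullet> d + L / 2 * (norm d)\<^sup>2"
proof -
  define \<phi> where "\<phi> t = f (y + t *\<^sub>R d) - t * (grad f y \<bullet> d) - L / 2 * t\<^sup>2 * (norm d)\<^sup>2" for t
  have "\<phi> 1 \<le> \<phi> 0"
  proof (rule DERIV_nonpos_imp_nonincreasing[of 0 1 \<phi>])
    fix t :: real assume t: "0 \<le> t" "t \<le> 1"
    let ?G = "grad f (y + t *\<^sub>R d)"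
    have "((\<lambda>t. f (y + t *\<^sub>R d)) has_derivative (\<lambda>h. (h *\<^sub>R d) \<bullet> ?G)) (at t)"
      by (rule has_derivative_compose[where f = "\<lambda>t. y + t *\<^sub>R d" and g = f])
         (use GDERIV_grad[OF diff] in \<open>auto simp: gderiv_def intro!: derivative_eq_intros\<close>)
    hence "((\<lambda>t. f (y + t *\<^sub>R d)) has_real_derivative (?G \<bullet> d)) (at t)"
      by (simp add: has_field_derivative_def inner_commute mult_commute_abs)
    hence D: "(\<phi> has_real_derivative (?G \<bullet> d - grad f y \<bullet> d - L * t * (norm d)\<^sup>2)) (at t)"
      unfolding \<phi>_def by (auto intro!: derivative_eq_intros)
    have "?G \<bullet> d - grad f y \<bullet> d \<le> norm (?G - grad f y) * norm d"
      by (metis inner_diff_left norm_cauchy_schwarz)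
    also have "\<dots> \<le> (L * norm (t *\<^sub>R d)) * norm d"
      using lip[of "y + t *\<^sub>R d" y] by (intro mult_right_mono) auto
    also have "\<dots> = L * t * (norm d)\<^sup>2"
      using t by (simp add: power2_eq_square)
    finally show "\<exists>D. (\<phi> has_real_derivative D) (at t) \<and> D \<le> 0"
      using D by (intro exI conjI) auto
  qed simp
  thus ?thesis by (simp add: \<phi>_def)
qed

lemma RYU_radicand_nonneg:
  fixes A :: "real^'n^'m"
  assumes "proper_fun g" and \<alpha>: "\<alpha> > 0"
    and diff: "\<forall>z. f differentiable (at z)"
    and lip: "\<forall>z z'. norm (grad f z - grad f z') \<le> inverse \<alpha> * norm (z - z')"
    and x: "x \<in> eff_dom (primal A f g)"
    and u: "u \<in> eff_dom (\<lambda>v. - dual A f g v)"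
  shows "gap A f g x u / \<alpha> - (norm (u + grad f (A *v x)))\<^sup>2 / 4 \<ge> 0"
proof -
  obtain p q r where pqr: "g x = ereal p" "conjugate (\<lambda>z. ereal (f z)) (- u) = ereal q"
    "conjugate g (transpose A *v u) = ereal r" "gap A f g x u = f (A *v x) + p + q + r"
    using gap_decomp[OF assms(1) x u] by metis
  define y where "y = A *v x"
  define w where "w = u + grad f y"
  have "r \<ge> (transpose A *v u) \<bullet> x - p"
    using conjugate_ge[of "transpose A *v u" x g] pqr by simp
  also have "(transpose A *v u) \<bullet> x = u \<bullet> y"
    by (simp add: y_def dot_lmul_matrix)
  finally have r: "r \<ge> u \<bullet> y - p" .
  have q: "q \<ge> (- u) \<bullet> (y + (- \<alpha>) *\<^sub>R w) - f (y + (- \<alpha>) *\<^sub>R w)"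
    using conjugate_ge[of "- u" "y + (- \<alpha>) *\<^sub>R w" "\<lambda>z. ereal (f z)"] pqr by simp
  have "f (y + (- \<alpha>) *\<^sub>R w) \<le> f y + grad f y \<bullet> ((- \<alpha>) *\<^sub>R w) + inverse \<alpha> / 2 * (norm ((- \<alpha>) *\<^sub>R w))\<^sup>2"
    using descent diff lip by blast
  also have "inverse \<alpha> / 2 * (norm ((- \<alpha>) *\<^sub>R w))\<^sup>2 = \<alpha> / 2 * (norm w)\<^sup>2"
    using \<alpha> by (simp add: power_mult_distrib power2_eq_square)
  finally have fz: "f (y + (- \<alpha>) *\<^sub>R w) \<le> f y - \<alpha> * (grad f y \<bullet> w) + \<alpha> / 2 * (norm w)\<^sup>2"
    by simp
  have "(norm w)\<^sup>2 = u \<bullet> w + grad f y \<bullet> w"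
    by (simp add: w_def power2_norm_eq_inner inner_add_left)
  hence "\<alpha> * (norm w)\<^sup>2 = \<alpha> * (u \<bullet> w) + \<alpha> * (grad f y \<bullet> w)"
    by (simp add: distrib_left)
  with q r fz have "gap A f g x u \<ge> \<alpha> / 2 * (norm w)\<^sup>2"
    unfolding pqr(4) y_def[symmetric] inner_add_right inner_scaleR_right inner_minus_left
    by linarith
  hence "gap A f g x u / \<alpha> \<ge> (norm w)\<^sup>2 / 2"
    using \<alpha> by (simp add: field_simps)
  moreover have "(norm w)\<^sup>2 \<ge> 0" by simp
  ultimately show ?thesis unfolding w_def y_def by linarith
qed

end

theory Submission
  imports Defs
begin

text \<open>Put \<open>w = u + \<nabla>f(Ax)\<close> and \<open>G = gap / \<alpha>\<close>. The centres are at distance \<open>\<parallel>w\<parallel> / 2\<close>, and the squares of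
  \<open>\<parallel>w\<parallel> / 2\<close> and of the RYU radius add up to \<open>G\<close>; hence their sum is at most \<open>\<surd>(2 G)\<close>, which is the
  inclusion. If the balls coincide, then so do the centres, so \<open>w = 0\<close> and \<open>\<surd>G = \<surd>(2 G)\<close>; thus the
  gap vanishes, and by weak duality the pair is optimal.\<close>

text \<open>The RYU radicand is \<open>gap / \<alpha>\<close> minus a square, so its nonnegativity
  passes to the gap.\<close>

lemma gap_nonneg:
  fixes A :: "real^'n^'m"
  assumes "proper_fun g" and \<alpha>: "\<alpha> > 0"
    and "\<forall>z. f differentiable (at z)"
    and "\<forall>z z'. norm (grad f z - grad f z') \<le> inverse \<alpha> * norm (z - z')"
    and "x \<in> eff_dom (primal A f g)"
    and "u \<in> eff_dom (\<lambda>v. - dual A f g v)"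
  shows "gap A f g x u \<ge> 0"
proof -
  have "0 \<le> gap A f g x u / \<alpha> - (norm (u + grad f (A *v x)))\<^sup>2 / 4"
    using assms by (rule RYU_radicand_nonneg)
  also have "\<dots> \<le> gap A f g x u / \<alpha>" by simp
  finally show ?thesis using \<alpha> by (simp add: zero_le_divide_iff)
qed

lemma weak_duality:
  fixes A :: "real^'n^'m"
  assumes "proper_fun g" and "\<alpha> > 0"
    and "\<forall>z. f differentiable (at z)"
    and "\<forall>z z'. norm (grad f z - grad f z') \<le> inverse \<alpha> * norm (z - z')"
  shows "dual A f g u \<le> primal A f g x"
proof (cases "x \<in> eff_dom (primal A f g) \<and> u \<in> eff_dom (\<lambda>v. - dual A f g v)")
  case True
  then obtain p q r where "primal A f g x = ereal (f (A *v x) + p)" "dual A f g u = ereal (- q - r)"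
    "gap A f g x u = f (A *v x) + p + q + r"
    using gap_decomp[OF assms(1)] by metis
  moreover have "gap A f g x u \<ge> 0"
    using gap_nonneg[OF assms] True by blast
  ultimately show ?thesis by simp
next
  \<comment> \<open>Outside the domains the primal value is \<open>\<infinity>\<close> or the dual
    value is \<open>-\<infinity>\<close>, so the inequality is trivial.\<close>
  case False
  then show ?thesis
    by (auto simp: eff_dom_def ereal_uminus_eq_reorder)
qed

text \<open>A zero gap makes the two finite values equal. Weak duality then makes this common value
  a lower bound for the primal and an upper bound for the dual.\<close>

lemma optimal_pair_if_gap_zero:
  fixes A :: "real^'n^'m"
  assumes "proper_fun g" and "\<alpha> > 0"
    and "\<forall>z. f differentiable (at z)"
    and "\<forall>z z'. norm (grad f z - grad f z') \<le> inverse \<alpha> * norm (z - z')"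
    and x: "x \<in> eff_dom (primal A f g)"
    and u: "u \<in> eff_dom (\<lambda>v. - dual A f g v)"
    and "gap A f g x u = 0"
  shows "optimal_pair A f g x u"
proof -
  obtain p q r where "primal A f g x = ereal (f (A *v x) + p)" "dual A f g u = ereal (- q - r)"
    "gap A f g x u = f (A *v x) + p + q + r"
    using gap_decomp[OF assms(1) x u] by metis
  with assms(7) have "primal A f g x = dual A f g u" by simp
  then show ?thesis
    using weak_duality[OF assms(1-4)] unfolding optimal_pair_def by metis
qed

theorem proposition4p4:
  fixes A :: "real^'n^'m"
    and f :: "real^'m \<Rightarrow> real"
    and g :: "real^'n \<Rightarrow> ereal"
    and \<alpha> :: real
  assumes "proper_fun (\<lambda>z. ereal (f z))" and "closed_fun (\<lambda>z. ereal (f z))"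
    and "convex_fun (\<lambda>z. ereal (f z))"
    and "proper_fun g" and "closed_fun g" and "convex_fun g"
    and "\<alpha> > 0"
    and "\<forall>z. f differentiable (at z)"
    and "\<forall>z z'. norm (grad f z - grad f z') \<le> inverse \<alpha> * norm (z - z')"
    and "\<exists>x. \<forall>y. primal A f g x \<le> primal A f g y"
  shows "\<forall>x \<in> eff_dom (primal A f g). \<forall>u \<in> eff_dom (\<lambda>v. - dual A f g v).
           B_RYU A f g \<alpha> x u \<subseteq> cball (c_GAP u) (r_GAP A f g \<alpha> x u) \<and>
           (\<not> optimal_pair A f g x u \<longrightarrow>
              B_RYU A f g \<alpha> x u \<subset> cball (c_GAP u) (r_GAP A f g \<alpha> x u))"
proof (intro ballI)
  fix x u assume x: "x \<in> eff_dom (primal A f g)" and u: "u \<in> eff_dom (\<lambda>v. - dual A f g v)"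
  define G where "G = gap A f g x u / \<alpha>"
  define a where "a = norm (u + grad f (A *v x)) / 2"
  define b where "b = r_RYU A f g \<alpha> x u"
  have b: "b = sqrt (G - a\<^sup>2)"
    by (simp add: b_def r_RYU_def G_def a_def power_divide)
  have rad: "0 \<le> G - a\<^sup>2"
    using RYU_radicand_nonneg[OF assms(4,7-9) x u] by (simp add: G_def a_def power_divide)
  have "c_RYU A f x u - u = - ((1/2) *\<^sub>R (u + grad f (A *v x)))"
    unfolding c_RYU_def by (simp add: vec_eq_iff field_simps)
  then have a: "dist (c_RYU A f x u) u = a"
    by (simp add: dist_norm a_def)
  have R: "r_GAP A f g \<alpha> x u = sqrt (2 * G)"
    by (simp add: r_GAP_def G_def)
  \<comment> \<open>The right side exceeds the left by \<open>(a - b)\<^sup>2\<close>.\<close>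
  have "(a + b)\<^sup>2 \<le> 2 * (a\<^sup>2 + b\<^sup>2)"
    using zero_le_power2[of "a - b"] by (simp add: power2_sum power2_diff)
  also have "\<dots> = 2 * G"
    using rad by (simp add: b)
  finally have sub: "a + b \<le> sqrt (2 * G)"
    by (rule real_le_rsqrt)
  \<comment> \<open>A ball lies in another once the distance of the centres plus its own radius is
    at most the other radius.\<close>
  have incl: "B_RYU A f g \<alpha> x u \<subseteq> cball (c_GAP u) (r_GAP A f g \<alpha> x u)"
    using sub by (simp add: B_RYU_def c_GAP_def R b_def[symmetric] cball_subset_cball_iff a)
  moreover have "optimal_pair A f g x u"
    if "B_RYU A f g \<alpha> x u = cball (c_GAP u) (r_GAP A f g \<alpha> x u)"
  proof -
    \<comment> \<open>Two balls of negative radius are both empty, hence equal whatever their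
      centres; \<open>b \<ge> 0\<close> excludes this case.\<close>
    have "b \<ge> 0" using rad by (simp add: b)
    with that have "c_RYU A f x u = u" "b = sqrt (2 * G)"
      by (auto simp: B_RYU_def c_GAP_def R b_def[symmetric] cball_eq_cball_iff)
    \<comment> \<open>Coinciding centres give \<open>a = 0\<close>, so \<open>b\<close> is both
      \<open>sqrt G\<close> and \<open>sqrt (2 * G)\<close>.\<close>
    with a b have "G = 0" by simp
    with assms(7) have "gap A f g x u = 0" by (simp add: G_def)
    with optimal_pair_if_gap_zero[OF assms(4,7-9) x u] show ?thesis .
  qed
  ultimately show "B_RYU A f g \<alpha> x u \<subseteq> cball (c_GAP u) (r_GAP A f g \<alpha> x u) \<and>
      (\<not> optimal_pair A f g x u \<longrightarrow> B_RYU A f g \<alpha> x u \<subset> cball (c_GAP u) (r_GAP A f g \<alpha> x u))"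
    by blast
qed

end
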